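(* For all integers $i,j\geq 3$ with $i\neq j$, the graph polynomials $\chi_{\mathcal{C}_i}$ and $\chi_{\mathcal{C}_j}$ are d.p.-incomparable, i.e., neither $\chi_{\mathcal{C}_i}\leq_{d.p.}\chi_{\mathcal{C}_j}$ nor $\chi_{\mathcal{C}_j}\leq_{d.p.}\chi_{\mathcal{C}_i}$. Hence there are infinitely many pairwise d.p.-incomparable graph polynomials of the form $\chi_{\mathcal{C}}$.
   Context: All graphs are finite without multiple edges. $C_i$ is the cycle on $i$ vertices and $\mathcal{C}_i$ is the class of all graphs isomorphic to $C_i$. For a graph property $\mathcal{C}$ and $k\in\mathbb{N}$, $\chi_{\mathcal{C}}(G;k)$ is the number of maps $f:V(G)\to\{1,\dots,k\}$ such that each nonempty color class $f^{-1}(c)$ induces a graph in $\mathcal{C}$; it is known to be a polynomial in $k$, denoted $\chi_{\mathcal{C}}(G;X)$. $\mathbf{P}\leq_{d.p.}\mathbf{Q}$ means: for all graphs $G_1,G_2$, $\mathbf{Q}(G_1)=\mathbf{Q}(G_2)$ implies $\mathbf{P}(G_1)=\mathbf{P}(G_2)$. *)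

theory Defs
  imports
    "Graph_Theory.Graph_Theory"
    "HOL-Computational_Algebra.Polynomial"
    "HOL-Library.FuncSet"
begin

text \<open>
  An undirected graph is a symmetric digraph satisfying the locale \<^locale>\<open>graph\<close>: finite,
  loop-free, without parallel arcs. Every such graph is isomorphic to one with vertices in
  \<^typ>\<open>nat\<close> and arcs in \<^typ>\<open>nat \<times> nat\<close>, and this type stands for the class of all graphs.
\<close>

type_synonym ngraph = "(nat, nat \<times> nat) pre_digraph"

definition graph_property :: "ngraph set \<Rightarrow> bool" where
  "graph_property \<C> \<longleftrightarrow>
     (\<forall>G\<in>\<C>. graph G) \<and> (\<forall>G\<in>\<C>. \<forall>H. digraph_iso G H \<longrightarrow> H \<in> \<C>)"

definition property_colorings :: "ngraph set \<Rightarrow> ngraph \<Rightarrow> nat \<Rightarrow> (nat \<Rightarrow> nat) set" where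
  "property_colorings \<C> G k =
     {f \<in> verts G \<rightarrow>\<^sub>E {1..k}. \<forall>c\<in>{1..k}.
        {v \<in> verts G. f v = c} \<noteq> {} \<longrightarrow> G \<restriction> {v \<in> verts G. f v = c} \<in> \<C>}"

definition chi :: "ngraph set \<Rightarrow> ngraph \<Rightarrow> int poly" where
  "chi \<C> G = (THE p. \<forall>k. poly p (int k) = int (card (property_colorings \<C> G k)))"

text \<open>The intended range is \<open>n \<ge> 3\<close>.\<close>

definition cycle_graph :: "nat \<Rightarrow> ngraph" where
  "cycle_graph n = with_proj
     \<lparr> pverts = {..<n},
       parcs = {(u, v). u < n \<and> v < n \<and> (v = Suc u mod n \<or> u = Suc v mod n)} \<rparr>"

definition cycle_class :: "nat \<Rightarrow> ngraph set" where
  "cycle_class n = {G. graph G \<and> digraph_iso G (cycle_graph n)}"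

definition dp_le :: "(ngraph \<Rightarrow> 'p) \<Rightarrow> (ngraph \<Rightarrow> 'q) \<Rightarrow> bool" (infix \<open>\<le>\<^sub>d\<^sub>p\<close> 50) where
  "P \<le>\<^sub>d\<^sub>p Q \<longleftrightarrow> (\<forall>G\<^sub>1 G\<^sub>2. graph G\<^sub>1 \<longrightarrow> graph G\<^sub>2 \<longrightarrow> Q G\<^sub>1 = Q G\<^sub>2 \<longrightarrow> P G\<^sub>1 = P G\<^sub>2)"

definition dp_incomparable :: "(ngraph \<Rightarrow> 'p) \<Rightarrow> (ngraph \<Rightarrow> 'q) \<Rightarrow> bool" where
  "dp_incomparable P Q \<longleftrightarrow> \<not> P \<le>\<^sub>d\<^sub>p Q \<and> \<not> Q \<le>\<^sub>d\<^sub>p P"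


text \<open>
  The description in \<^const>\<open>chi\<close> always denotes: the colour class of a fixed vertex can be split
  off, which gives a recursion for the number of colourings.
\<close>

definition set_colorings :: "('a set \<Rightarrow> bool) \<Rightarrow> 'a set \<Rightarrow> nat set \<Rightarrow> ('a \<Rightarrow> nat) set" where
  "set_colorings Q V K =
     {f \<in> V \<rightarrow>\<^sub>E K. \<forall>c\<in>K. {v \<in> V. f v = c} \<noteq> {} \<longrightarrow> Q {v \<in> V. f v = c}}"

lemma set_colorings_split:
  assumes w: "w \<in> V"
  shows "bij_betw (\<lambda>(U, c, g). \<lambda>v. if v \<in> U then c else g v)
           (SIGMA U:{U. U \<subseteq> V \<and> w \<in> U \<and> Q U}. SIGMA c:K. set_colorings Q (V - U) (K - {c}))
           (set_colorings Q V K)"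
    (is "bij_betw ?h ?A ?B")
proof (rule bij_betw_byWitness[where f' =
    "\<lambda>f. ({v \<in> V. f v = f w}, f w, restrict f (V - {v \<in> V. f v = f w}))"])
  show "\<forall>a\<in>?A. ({v \<in> V. ?h a v = ?h a w}, ?h a w,
                restrict (?h a) (V - {v \<in> V. ?h a v = ?h a w})) = a"
  proof
    fix a assume "a \<in> ?A"
    then obtain U c g where a: "a = (U, c, g)" and U: "U \<subseteq> V" "w \<in> U"
      and g: "g \<in> set_colorings Q (V - U) (K - {c})" by auto
    have gE: "g \<in> (V - U) \<rightarrow>\<^sub>E (K - {c})" using g by (simp add: set_colorings_def)
    let ?f = "\<lambda>v. if v \<in> U then c else g v"
    have cls: "{v \<in> V. ?f v = ?f w} = U" using gE U by (auto dest: PiE_mem)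
    have "restrict ?f (V - U) = g"
      using PiE_arb[OF gE] by (intro ext) (simp add: restrict_def)
    then show "({v \<in> V. ?h a v = ?h a w}, ?h a w,
                restrict (?h a) (V - {v \<in> V. ?h a v = ?h a w})) = a"
      unfolding a prod.case cls using U by simp
  qed
  show "\<forall>f\<in>?B. ?h ({v \<in> V. f v = f w}, f w, restrict f (V - {v \<in> V. f v = f w})) = f"
  proof
    fix f assume "f \<in> ?B"
    then have "f \<in> V \<rightarrow>\<^sub>E K" by (simp add: set_colorings_def)
    from PiE_arb[OF this]
    show "?h ({v \<in> V. f v = f w}, f w, restrict f (V - {v \<in> V. f v = f w})) = f"
      by (intro ext) (simp add: restrict_def)
  qed
  show "?h ` ?A \<subseteq> ?B"
  proof (rule image_subsetI)
    fix a assume "a \<in> ?A"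
    then obtain U c g where a: "a = (U, c, g)" and U: "U \<subseteq> V" "w \<in> U" "Q U" and c: "c \<in> K"
      and g: "g \<in> set_colorings Q (V - U) (K - {c})" by auto
    have gE: "g \<in> (V - U) \<rightarrow>\<^sub>E (K - {c})" using g by (simp add: set_colorings_def)
    let ?f = "\<lambda>v. if v \<in> U then c else g v"
    have "?f \<in> V \<rightarrow>\<^sub>E K" using gE c U by (auto simp: PiE_iff extensional_def)
    moreover have "Q {v \<in> V. ?f v = d}" if d: "d \<in> K" "{v \<in> V. ?f v = d} \<noteq> {}" for d
    proof (cases "d = c")
      case True
      then have "{v \<in> V. ?f v = d} = U" using gE U by (auto dest: PiE_mem)
      then show ?thesis using U by simp
    next
      case False
      then have "{v \<in> V. ?f v = d} = {v \<in> V - U. g v = d}" using U by auto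
      then show ?thesis using g d False by (auto simp: set_colorings_def)
    qed
    ultimately show "?h a \<in> ?B" by (simp add: a set_colorings_def)
  qed
  show "(\<lambda>f. ({v \<in> V. f v = f w}, f w, restrict f (V - {v \<in> V. f v = f w}))) ` ?B \<subseteq> ?A"
  proof (rule image_subsetI)
    fix f assume f: "f \<in> ?B"
    let ?U = "{v \<in> V. f v = f w}"
    let ?g = "restrict f (V - ?U)"
    have fw: "f w \<in> K" using f w by (auto simp: set_colorings_def)
    have "Q ?U" using f w fw by (auto simp: set_colorings_def)
    moreover have "?g \<in> (V - ?U) \<rightarrow>\<^sub>E (K - {f w})"
      using f by (auto simp: set_colorings_def)
    moreover have "Q {v \<in> V - ?U. ?g v = d}"
      if d: "d \<in> K - {f w}" "{v \<in> V - ?U. ?g v = d} \<noteq> {}" for d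
    proof -
      have "{v \<in> V - ?U. ?g v = d} = {v \<in> V. f v = d}" using d by auto
      then show ?thesis using f d by (auto simp: set_colorings_def)
    qed
    ultimately have "Q ?U" "?g \<in> set_colorings Q (V - ?U) (K - {f w})"
      unfolding set_colorings_def by blast+
    then show "(?U, f w, ?g) \<in> ?A"
      using w fw by blast
  qed
qed

lemma finite_set_colorings:
  "finite V \<Longrightarrow> finite K \<Longrightarrow> finite (set_colorings Q V K)"
  unfolding set_colorings_def by (rule finite_subset[OF _ finite_PiE[of V "\<lambda>_. K"]]) auto

lemma set_colorings_polynomial:
  assumes "finite V"
  shows "\<exists>p :: int poly. \<forall>K. finite K \<longrightarrow> poly p (int (card K)) = int (card (set_colorings Q V K))"
  using assms
proof (induction V rule: finite_psubset_induct)
  case (psubset V)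
  show ?case
  proof (cases "V = {}")
    case True
    then have "set_colorings Q V K = {\<lambda>_. undefined}" for K
      by (auto simp: set_colorings_def)
    then show ?thesis by (intro exI[of _ 1]) simp
  next
    case False
    then obtain w where w: "w \<in> V" by blast
    let ?I = "{U. U \<subseteq> V \<and> w \<in> U \<and> Q U}"
    have finI: "finite ?I" using psubset.hyps by simp
    have "\<forall>U\<in>?I. \<exists>p :: int poly. \<forall>K. finite K \<longrightarrow>
            poly p (int (card K)) = int (card (set_colorings Q (V - U) K))"
      using w by (intro ballI psubset.IH) auto
    then obtain p :: "'a set \<Rightarrow> int poly" where
      p: "\<And>U K. U \<in> ?I \<Longrightarrow> finite K \<Longrightarrow>
            poly (p U) (int (card K)) = int (card (set_colorings Q (V - U) K))"
      by metis
    let ?p = "\<Sum>U\<in>?I. [:0, 1:] * pcompose (p U) [:-1, 1:]"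
    have "poly ?p (int (card K)) = int (card (set_colorings Q V K))" if K: "finite K" for K
    proof -
      have inner: "int (card (set_colorings Q (V - U) (K - {c}))) = poly (p U) (int (card K) - 1)"
        if "U \<in> ?I" "c \<in> K" for U c
      proof -
        have "card K > 0" using that K by (auto simp: card_gt_0_iff)
        then have "int (card (K - {c})) = int (card K) - 1"
          using that K by simp
        then show ?thesis using p[OF that(1), of "K - {c}"] K by simp
      qed
      have fin: "finite (set_colorings Q (V - U) (K - {c}))" for U c
        using psubset.hyps K by (intro finite_set_colorings) auto
      have "card (set_colorings Q V K) =
          card (SIGMA U:?I. SIGMA c:K. set_colorings Q (V - U) (K - {c}))"
        using bij_betw_same_card[OF set_colorings_split[OF w, of Q K]] by simp
      also have "\<dots> = (\<Sum>U\<in>?I. \<Sum>c\<in>K. card (set_colorings Q (V - U) (K - {c})))"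
        using finI K fin by simp
      finally have "int (card (set_colorings Q V K)) =
          (\<Sum>U\<in>?I. \<Sum>c\<in>K. int (card (set_colorings Q (V - U) (K - {c}))))"
        by simp
      also have "\<dots> = (\<Sum>U\<in>?I. \<Sum>c\<in>K. poly (p U) (int (card K) - 1))"
        by (intro sum.cong refl inner) auto
      also have "\<dots> = poly ?p (int (card K))"
        by (simp add: poly_sum poly_pcompose)
      finally show ?thesis by simp
    qed
    then show ?thesis by blast
  qed
qed

lemma poly_chi:
  assumes "graph G"
  shows "poly (chi \<C> G) (int k) = int (card (property_colorings \<C> G k))"
proof -
  interpret graph G by fact
  have eq: "property_colorings \<C> G k = set_colorings (\<lambda>U. G \<restriction> U \<in> \<C>) (verts G) {1..k}" for k
    by (simp add: property_colorings_def set_colorings_def)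
  obtain p :: "int poly" where "\<And>K. finite K \<Longrightarrow>
      poly p (int (card K)) = int (card (set_colorings (\<lambda>U. G \<restriction> U \<in> \<C>) (verts G) K))"
    using set_colorings_polynomial[OF finite_verts] by blast
  from this[of "{1.._}"] have p: "\<forall>k. poly p (int k) = int (card (property_colorings \<C> G k))"
    by (simp add: eq)
  have uniq: "q = p" if "\<forall>k. poly q (int k) = int (card (property_colorings \<C> G k))" for q
  proof (rule ccontr)
    assume "q \<noteq> p"
    then have "finite {x. poly (q - p) x = 0}" by (intro poly_roots_finite) simp
    moreover have "range int \<subseteq> {x. poly (q - p) x = 0}" using that p by auto
    ultimately have "finite (range int)" by (rule finite_subset[rotated])
    then show False using finite_imageD[of int UNIV] by (simp add: inj_on_def)
  qed
  have "\<forall>k. poly (chi \<C> G) (int k) = int (card (property_colorings \<C> G k))"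
    unfolding chi_def by (rule theI[of _ p]) (rule p, erule uniq)
  then show ?thesis ..
qed

lemma graph_cycle_graph:
  assumes "n \<ge> 3"
  shows "graph (cycle_graph n)"
proof -
  have ne: "u \<noteq> Suc u mod n" "Suc u mod n \<noteq> u" if "u < n" for u
    using assms that by (cases "Suc u = n"; auto)+
  have "pair_graph \<lparr> pverts = {..<n},
       parcs = {(u, v). u < n \<and> v < n \<and> (v = Suc u mod n \<or> u = Suc v mod n)} \<rparr>" (is "pair_graph ?C")
  proof
    show "finite (parcs ?C)"
      by (rule finite_subset[of _ "{..<n} \<times> {..<n}"]) auto
    show "symmetric (with_proj ?C)" by (auto simp: symmetric_def sym_def)
  qed (use ne in auto)
  then show ?thesis unfolding cycle_graph_def by (rule pair_graph.pair_graphD_graph)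
qed

end

theory Submission
  imports Defs
begin

text \<open>
  The graphs \<open>C\<^sub>i\<close> and \<open>K\<^sub>1\<close> separate \<open>\<chi>\<^bsub>C\<^sub>i\<^esub>\<close> from \<open>\<chi>\<^bsub>C\<^sub>j\<^esub>\<close>. No nonempty vertex set of \<open>K\<^sub>1\<close> induces
  a cycle, and a nonempty proper vertex set of \<open>C\<^sub>i\<close> contains a vertex whose successor it misses,
  so that it does not induce a \<open>2\<close>-regular graph. Hence \<open>\<chi>\<^bsub>C\<^sub>j\<^esub>\<close> vanishes on both graphs, and
  \<open>\<chi>\<^bsub>C\<^sub>i\<^esub>\<close> vanishes on \<open>K\<^sub>1\<close>, whereas one colour suffices for \<open>C\<^sub>i\<close>.
\<close>

text \<open>An isomorphism is injective on vertices and arcs and commutes with tails and heads, so a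
  loop or a pair of parallel arcs would pull back to \<open>G\<close>.\<close>

lemma graph_digraph_iso:
  assumes "graph G" "digraph_iso G H"
  shows "graph H"
proof -
  interpret graph G by fact
  obtain f where f: "digraph_isomorphism f" and H: "H = app_iso f G"
    using assms(2) by (auto simp: digraph_iso_def)
  interpret H: fin_digraph H unfolding H using f ..
  show ?thesis
  proof unfold_locales
    fix e assume "e \<in> arcs H"
    then show "tail H e \<noteq> head H e"
      using f no_loops by (auto simp: H iso_verts_tail iso_verts_head)
  next
    fix e1 e2 assume "e1 \<in> arcs H" "e2 \<in> arcs H" "arc_to_ends H e1 = arc_to_ends H e2"
    then show "e1 = e2"
      using f no_multi_arcs by (auto simp: H arc_to_ends_def iso_verts_tail iso_verts_head)
  next
    show "symmetric H"
      using sym_arcs f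
      by (auto simp: H symmetric_def arcs_ends_app_iso_eq sym_def)
  qed
qed

lemma graph_property_cycle_class: "graph_property (cycle_class n)"
  unfolding graph_property_def
proof (intro conjI ballI allI impI)
  fix G H :: ngraph assume G: "G \<in> cycle_class n" and iso: "digraph_iso G H"
  then interpret graph G by (simp add: cycle_class_def)
  have "digraph_iso H G" using wf_digraph iso by (rule digraph_iso_swap)
  then have "digraph_iso H (cycle_graph n)"
    using G digraph_iso_trans unfolding cycle_class_def by blast
  moreover have "graph H" using G iso graph_digraph_iso by (auto simp: cycle_class_def)
  ultimately show "H \<in> cycle_class n" by (simp add: cycle_class_def)
qed (simp add: cycle_class_def)

lemma cycle_graph_in_cycle_class:
  assumes "n \<ge> 3"
  shows "cycle_graph n \<in> cycle_class n"
proof -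
  interpret graph "cycle_graph n" using assms by (rule graph_cycle_graph)
  \<comment> \<open>\<open>app_iso\<close> takes the new head and tail maps from the isomorphism
    record, so the identity has to carry those of the graph itself.\<close>
  let ?id = "\<lparr> iso_verts = id, iso_arcs = id, iso_head = head (cycle_graph n),
               iso_tail = tail (cycle_graph n) \<rparr>"
  have "digraph_isomorphism ?id" "cycle_graph n = app_iso ?id (cycle_graph n)"
    by (simp_all add: digraph_isomorphism_def app_iso_def wf_digraph)
  then show ?thesis
    using graph_axioms unfolding cycle_class_def digraph_iso_def by blast
qed

text \<open>Every edge is a pair of opposite arcs, so the out-degree is the undirected
  degree.\<close>

lemma out_degree_cycle_graph:
  assumes "n \<ge> 3" "u < n"
  shows "out_degree (cycle_graph n) u = 2"
proof -
  \<comment> \<open>The cyclic predecessor of \<open>u\<close>; the case split handles the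
    wrap-around at 0.\<close>
  define p where "p = (if u = 0 then n - 1 else u - 1)"
  have p: "u = Suc v mod n \<longleftrightarrow> v = p" if "v < n" for v
    using assms that by (cases "Suc v = n") (auto simp: p_def)
  have lt: "p < n" "Suc u mod n < n" using assms by (auto simp: p_def)
  have "out_arcs (cycle_graph n) u = Pair u ` {v. v < n \<and> (v = Suc u mod n \<or> u = Suc v mod n)}"
    using assms by (auto simp: cycle_graph_def out_arcs_def)
  also have "{v. v < n \<and> (v = Suc u mod n \<or> u = Suc v mod n)} = {Suc u mod n, p}"
    using lt p by blast
  finally have "out_arcs (cycle_graph n) u = {(u, Suc u mod n), (u, p)}" by simp
  \<comment> \<open>Here \<open>n \<ge> 3\<close> matters: on two vertices successor and predecessor
    coincide.\<close>
  moreover have "Suc u mod n \<noteq> p"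
    using assms by (cases "Suc u = n") (auto simp: p_def)
  ultimately show ?thesis by (simp add: out_degree_def)
qed

lemma cycle_class_card_verts:
  assumes "G \<in> cycle_class n"
  shows "card (verts G) = n"
proof -
  obtain f where "pre_digraph.digraph_isomorphism G f" and eq: "cycle_graph n = app_iso f G"
    using assms by (auto simp: cycle_class_def digraph_iso_def)
  then have "card (verts (cycle_graph n)) = card (verts G)"
    by (simp add: card_image pre_digraph.digraph_isomorphism_inj_on_verts)
  then show ?thesis by (simp add: cycle_graph_def)
qed

lemma cycle_class_out_degree:
  assumes "n \<ge> 3" "G \<in> cycle_class n" "u \<in> verts G"
  shows "out_degree G u = 2"
proof -
  interpret graph G using assms(2) by (simp add: cycle_class_def)
  obtain f where f: "digraph_isomorphism f" and eq: "cycle_graph n = app_iso f G"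
    using assms by (auto simp: cycle_class_def digraph_iso_def)
  have "iso_verts f u \<in> verts (cycle_graph n)" using assms(3) by (simp add: eq)
  then have "out_degree (cycle_graph n) (iso_verts f u) = 2"
    by (intro out_degree_cycle_graph assms(1)) (simp add: cycle_graph_def)
  then show ?thesis
    using out_degree_app_iso_eq[OF f assms(3)] by (simp add: eq)
qed

text \<open>Iterating the successor from any one element runs through all residues.\<close>

lemma closed_under_cyclic_Suc:
  assumes "U \<subseteq> {..<n}" "U \<noteq> {}" and closed: "\<And>u. u \<in> U \<Longrightarrow> Suc u mod n \<in> U"
  shows "U = {..<n :: nat}"
proof -
  obtain w where w: "w \<in> U" using assms(2) by blast
  have reach: "(w + k) mod n \<in> U" for k
  proof (induction k)
    case 0
    then show ?case using w assms(1) by auto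
  next
    case (Suc k)
    then show ?case using closed[OF Suc] by (simp add: mod_Suc_eq)
  qed
  have "v \<in> U" if "v < n" for v
  proof -
    \<comment> \<open>As \<open>w < n\<close>, the subtraction is exact: \<open>n - w\<close> steps
      lead from \<open>w\<close> round to 0, and \<open>v\<close> more lead to
      \<open>v\<close>.\<close>
    have "w + (n - w + v) = n + v" using w assms(1) by auto
    then show ?thesis using reach[of "n - w + v"] that by simp
  qed
  then show ?thesis using assms(1) by auto
qed

lemma induced_cycle_in_cycle_graph:
  assumes "i \<ge> 3" "j \<ge> 3" "U \<subseteq> verts (cycle_graph i)" "U \<noteq> {}"
    and cyc: "cycle_graph i \<restriction> U \<in> cycle_class j"
  shows "i = j"
proof -
  interpret graph "cycle_graph i" using assms(1) by (rule graph_cycle_graph)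
  have U: "U \<subseteq> {..<i}" using assms(3) by (simp add: cycle_graph_def)
  have "Suc u mod i \<in> U" if u: "u \<in> U" for u
  proof (rule ccontr)
    \<comment> \<open>If the successor of \<open>u\<close> is missing, this arc is lost in the
      induced graph, which pushes the out-degree of \<open>u\<close> below 2.\<close>
    let ?a = "(u, Suc u mod i)"
    assume "Suc u mod i \<notin> U"
    then have "?a \<notin> out_arcs (cycle_graph i \<restriction> U) u"
      by (simp add: cycle_graph_def)
    moreover have "?a \<in> out_arcs (cycle_graph i) u"
      using u U by (auto simp: cycle_graph_def)
    moreover have "out_arcs (cycle_graph i \<restriction> U) u \<subseteq> out_arcs (cycle_graph i) u"
      by (auto simp: out_arcs_def)
    ultimately have "out_arcs (cycle_graph i \<restriction> U) u \<subset> out_arcs (cycle_graph i) u"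
      by blast
    then have "out_degree (cycle_graph i \<restriction> U) u < out_degree (cycle_graph i) u"
      unfolding out_degree_def by (intro psubset_card_mono) auto
    moreover have "u < i" using u U by auto
    ultimately show False
      using cycle_class_out_degree[OF assms(2) cyc, of u] out_degree_cycle_graph[OF assms(1), of u] u
      by simp
  qed
  then have "U = {..<i}" by (intro closed_under_cyclic_Suc U assms(4))
  then show ?thesis using cycle_class_card_verts[OF cyc] by simp
qed

text \<open>The class of any vertex is nonempty, so no number of colours admits a colouring, and a
  polynomial with infinitely many roots is 0. The empty graph is different: it has exactly one
  colouring for each \<open>k\<close>.\<close>

lemma chi_eq_0:
  assumes "graph G" "verts G \<noteq> {}"
    and no: "\<And>U. U \<subseteq> verts G \<Longrightarrow> U \<noteq> {} \<Longrightarrow> G \<restriction> U \<notin> \<C>"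
  shows "chi \<C> G = 0"
proof -
  obtain w where w: "w \<in> verts G" using assms(2) by blast
  have "property_colorings \<C> G k = {}" for k
  proof (rule equals0I)
    fix f assume f: "f \<in> property_colorings \<C> G k"
    let ?U = "{v \<in> verts G. f v = f w}"
    have "f w \<in> {1..k}" using f w by (auto simp: property_colorings_def)
    then have "G \<restriction> ?U \<in> \<C>" using f w unfolding property_colorings_def by blast
    then show False using no[of ?U] w by auto
  qed
  then have "range int \<subseteq> {x. poly (chi \<C> G) x = 0}"
    using poly_chi[OF assms(1), of \<C>] by auto
  moreover have "infinite (range int)" by (simp add: range_inj_infinite)
  ultimately show ?thesis using poly_roots_finite finite_subset by metis
qed

lemma chi_cycle_graph_self_nonzero:
  assumes "n \<ge> 3"
  shows "chi (cycle_class n) (cycle_graph n) \<noteq> 0"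
proof -
  let ?G = "cycle_graph n"
  interpret graph ?G using assms by (rule graph_cycle_graph)
  \<comment> \<open>The only class of the constant colouring is the whole vertex set, which induces
    \<open>?G\<close> itself; hence the polynomial is positive at 1.\<close>
  have "?G \<restriction> verts ?G = ?G" by (auto intro!: pre_digraph.equality)
  then have "restrict (\<lambda>_. 1) (verts ?G) \<in> property_colorings (cycle_class n) ?G 1"
    using cycle_graph_in_cycle_class[OF assms] by (auto simp: property_colorings_def)
  moreover have "finite (property_colorings (cycle_class n) ?G 1)"
    unfolding property_colorings_def
    by (rule finite_subset[OF _ finite_PiE[of "verts ?G" "\<lambda>_. {1..1}"]]) auto
  ultimately have "card (property_colorings (cycle_class n) ?G 1) \<noteq> 0" by auto
  then show ?thesis using poly_chi[OF graph_axioms, of "cycle_class n" 1] by auto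
qed

lemma not_dp_le_chi_cycle_class:
  assumes "i \<ge> 3" "j \<ge> 3" "i \<noteq> j"
  shows "\<not> chi (cycle_class i) \<le>\<^sub>d\<^sub>p chi (cycle_class j)"
proof
  assume le: "chi (cycle_class i) \<le>\<^sub>d\<^sub>p chi (cycle_class j)"
  define K :: ngraph where "K = with_proj \<lparr> pverts = {0}, parcs = {} \<rparr>"
  have K: "graph K"
    by unfold_locales (auto simp: K_def symmetric_def sym_def)
  have chi_K: "chi (cycle_class n) K = 0" if "n \<ge> 3" for n
  proof (rule chi_eq_0[OF K])
    fix U assume "U \<subseteq> verts K"
    \<comment> \<open>An induced subgraph of \<open>K\<close> has at most one vertex, too few for a
      cycle.\<close>
    then have "card U \<le> card {0 :: nat}" by (intro card_mono) (auto simp: K_def)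
    then show "K \<restriction> U \<notin> cycle_class n"
      using that cycle_class_card_verts[of "K \<restriction> U" n] by auto
  qed (simp add: K_def)
  have C: "graph (cycle_graph i)" using assms(1) by (rule graph_cycle_graph)
  have "chi (cycle_class j) (cycle_graph i) = 0"
  proof (rule chi_eq_0[OF C])
    show "verts (cycle_graph i) \<noteq> {}" using assms(1) by (simp add: cycle_graph_def lessThan_empty_iff)
  qed (use induced_cycle_in_cycle_graph[OF assms(1,2)] assms(3) in blast)
  \<comment> \<open>The polynomial for \<open>j\<close> is 0 on both \<open>cycle_graph i\<close>
    and \<open>K\<close>, so \<open>le\<close> would carry the value 0 of the polynomial for
    \<open>i\<close> from \<open>K\<close> to \<open>cycle_graph i\<close>.\<close>
  then have "chi (cycle_class i) (cycle_graph i) = 0"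
    using le C K chi_K[OF assms(1)] chi_K[OF assms(2)] unfolding dp_le_def by metis
  then show False using chi_cycle_graph_self_nonzero[OF assms(1)] by simp
qed

theorem theorem14:
  shows "(\<forall>i j :: nat. i \<ge> 3 \<longrightarrow> j \<ge> 3 \<longrightarrow> i \<noteq> j \<longrightarrow>
            dp_incomparable (chi (cycle_class i)) (chi (cycle_class j))) \<and>
         (\<exists>\<P> :: (ngraph \<Rightarrow> int poly) set. infinite \<P> \<and>
            (\<forall>P\<in>\<P>. \<exists>\<C>. graph_property \<C> \<and> P = chi \<C>) \<and>
            pairwise dp_incomparable \<P>)"
proof -
  have inc: "dp_incomparable (chi (cycle_class i)) (chi (cycle_class j))"
    if "i \<ge> 3" "j \<ge> 3" "i \<noteq> j" for i j
    using that not_dp_le_chi_cycle_class by (auto simp: dp_incomparable_def)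
  let ?P = "(\<lambda>i. chi (cycle_class i)) ` {3..}"
  \<comment> \<open>Incomparability is irreflexive, so distinct cycle lengths give distinct
    polynomials; this injectivity makes the family infinite.\<close>
  have "\<not> dp_incomparable P P" for P :: "ngraph \<Rightarrow> int poly"
    by (simp add: dp_incomparable_def dp_le_def)
  with inc have "i = j"
    if "i \<ge> 3" "j \<ge> 3" "chi (cycle_class i) = chi (cycle_class j)" for i j
    using that by fastforce
  then have "inj_on (\<lambda>i. chi (cycle_class i)) {3..}" by (simp add: inj_on_def)
  then have "infinite ?P" using infinite_Ici finite_imageD by blast
  moreover have "\<forall>P\<in>?P. \<exists>\<C>. graph_property \<C> \<and> P = chi \<C>"
    using graph_property_cycle_class by blast
  moreover have "pairwise dp_incomparable ?P"
    using inc by (auto simp: pairwise_def)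
  ultimately show ?thesis using inc by blast
qed

end
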